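(* Let $n,t,\lambda,s_1,s_2$ be positive integers with $n>t>1$ and $\min\{s_1+1,s_2+1\}\le\lambda\le s_1+s_2$. Set $\chi=\max\{\lceil t/s_1\rceil,\lceil (n-t)/s_2\rceil\}$. Then \[m(n,t,\lambda;s_1+1,s_2+1)\le\frac{1}{n}\binom{n}{t}(\lambda-1)\left\lceil\frac{n}{\lfloor n/\chi\rfloor}\right\rceil.\]
   Context: $[m]=\{1,\dots,m\}$. A sequence $A_1,\dots,A_\lambda$ of subsets of $[n]$ (repetitions allowed) is $k_1$-disjoint if $\bigcap_{i\in B}A_i=\emptyset$ for every $k_1$-subset $B\subseteq[\lambda]$ (vacuous if $k_1>\lambda$), $k_2$-covering if $\bigcup_{i\in B}A_i=[n]$ for every $k_2$-subset $B\subseteq[\lambda]$ (vacuous if $k_2>\lambda$), and $(k_1,k_2)$-disjoint if both hold. $m(n,t,\lambda;k_1,k_2)$ is the maximum size of a family $\mathcal{F}$ of $t$-subsets of $[n]$ such that no $A_1,\dots,A_\lambda\in\mathcal{F}$ (not necessarily distinct) form a $(k_1,k_2)$-disjoint sequence. *)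

theory Defs
  imports Complex_Main
begin

text \<open>
  A sequence of length \<open>l\<close> of subsets of \<open>{1..n}\<close> is represented by a function
  \<open>A :: nat \<Rightarrow> nat set\<close> of which only the values on \<open>{1..l}\<close> matter.
\<close>

definition k_disjoint :: "nat \<Rightarrow> nat \<Rightarrow> (nat \<Rightarrow> nat set) \<Rightarrow> bool" where
  "k_disjoint k l A \<longleftrightarrow> (\<forall>B. B \<subseteq> {1..l} \<and> card B = k \<longrightarrow> (\<Inter>i\<in>B. A i) = {})"

definition k_covering :: "nat \<Rightarrow> nat \<Rightarrow> nat \<Rightarrow> (nat \<Rightarrow> nat set) \<Rightarrow> bool" where
  "k_covering n k l A \<longleftrightarrow> (\<forall>B. B \<subseteq> {1..l} \<and> card B = k \<longrightarrow> (\<Union>i\<in>B. A i) = {1..n})"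

definition kk_disjoint :: "nat \<Rightarrow> nat \<Rightarrow> nat \<Rightarrow> nat \<Rightarrow> (nat \<Rightarrow> nat set) \<Rightarrow> bool" where
  "kk_disjoint n k1 k2 l A \<longleftrightarrow> k_disjoint k1 l A \<and> k_covering n k2 l A"

definition admissible_family ::
    "nat \<Rightarrow> nat \<Rightarrow> nat \<Rightarrow> nat \<Rightarrow> nat \<Rightarrow> nat set set \<Rightarrow> bool" where
  "admissible_family n t l k1 k2 F \<longleftrightarrow>
     F \<subseteq> {S. S \<subseteq> {1..n} \<and> card S = t} \<and>
     \<not> (\<exists>A. (\<forall>i\<in>{1..l}. A i \<in> F) \<and> kk_disjoint n k1 k2 l A)"

text \<open>
  For \<open>l \<ge> 1\<close> the empty family is admissible, and there are only finitely many admissible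
  families, so the maximum below exists.
\<close>

definition m :: "nat \<Rightarrow> nat \<Rightarrow> nat \<Rightarrow> nat \<Rightarrow> nat \<Rightarrow> nat" where
  "m n t l k1 k2 = Max {card F | F. admissible_family n t l k1 k2 F}"

end

theory Submission
  imports Defs "HOL-Combinatorics.Permutations"
begin

text \<open>
  Katona's circle method with only \<open>d = n div \<chi>\<close> of the \<open>n\<close> arcs of length \<open>t\<close>: those with starting
  points \<open>0, \<chi>, \<dots>, (d - 1)\<chi>\<close> on the cycle of the residues modulo \<open>n\<close>. These points are pairwise at
  cyclic distance at least \<open>\<chi>\<close>, and \<open>t \<le> s1 \<chi>\<close>, \<open>n - t \<le> s2 \<chi>\<close>; hence every point lies on at most
  \<open>s1\<close> of the arcs and off at most \<open>s2\<close> of them. So under each permutation fewer than \<open>l\<close> of the arcs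
  are mapped into an admissible family \<open>F\<close>, and averaging over all permutations gives
  \<open>d |F| \<le> (l - 1) (n choose t)\<close>. The claim follows from \<open>1 / d \<le> \<lceil>n / d\<rceil> / n\<close>.
\<close>

section \<open>Averaging over permutations\<close>

text \<open>Glue a bijection from \<open>S\<close> to \<open>T\<close> with one between the
  complements in \<open>U\<close>, and fix everything outside \<open>U\<close>.\<close>

lemma permutes_image_transitive:
  assumes "finite U" "S \<subseteq> U" "T \<subseteq> U" "card S = card T"
  obtains p where "p permutes U" "p ` S = T"
proof -
  have fin: "finite S" "finite T" using assms finite_subset by auto
  obtain f where f: "bij_betw f S T"
    using finite_same_card_bij fin assms(4) by blast
  have "card (U - S) = card (U - T)"
    using assms fin by (simp add: card_Diff_subset)
  then obtain g where g: "bij_betw g (U - S) (U - T)"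
    using finite_same_card_bij assms(1) by blast
  define p where "p = (\<lambda>x. if x \<in> S then f x else if x \<in> U then g x else x)"
  have pS: "bij_betw p S T"
    using f by (rule bij_betw_cong[THEN iffD1, rotated]) (simp add: p_def)
  have pD: "bij_betw p (U - S) (U - T)"
    using g by (rule bij_betw_cong[THEN iffD1, rotated]) (simp add: p_def)
  have "bij_betw p (S \<union> (U - S)) (T \<union> (U - T))"
    using pS pD by (rule bij_betw_combine) auto
  then have "bij_betw p U U"
    using assms by (simp add: Un_absorb1)
  then have "p permutes U"
    by (rule bij_imp_permutes) (use assms(2) in \<open>auto simp: p_def\<close>)
  moreover have "p ` S = T" using pS by (rule bij_betw_imp_surj_on)
  ultimately show ?thesis by (rule that)
qed

text \<open>If \<open>q\<close> maps \<open>S'\<close> to \<open>S\<close> and \<open>r\<close> maps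
  \<open>T\<close> to \<open>T'\<close>, then \<open>p \<mapsto> r \<circ> p \<circ> q\<close>
  injects the first set of permutations into the second; the situation is symmetric, so the
  cardinalities agree.\<close>

lemma card_permutes_image_eq:
  assumes "finite U" "S \<subseteq> U" "T \<subseteq> U" "S' \<subseteq> U" "T' \<subseteq> U"
    and "card S = card S'" "card T = card T'"
  shows "card {p. p permutes U \<and> p ` S = T} = card {p. p permutes U \<and> p ` S' = T'}"
proof -
  have le: "card {p. p permutes U \<and> p ` S = T} \<le> card {p. p permutes U \<and> p ` S' = T'}"
    if sub: "S \<subseteq> U" "T \<subseteq> U" "S' \<subseteq> U" "T' \<subseteq> U" and eq: "card S = card S'" "card T = card T'"
    for S T S' T' :: "'a set"
  proof -
    obtain q where q: "q permutes U" "q ` S' = S"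
      using permutes_image_transitive[OF assms(1) sub(3,1)] eq by metis
    obtain r where r: "r permutes U" "r ` T = T'"
      using permutes_image_transitive[OF assms(1) sub(2,4)] eq by metis
    show ?thesis
    proof (rule card_inj_on_le)
      show "inj_on (\<lambda>p. r \<circ> p \<circ> q) {p. p permutes U \<and> p ` S = T}"
      proof (rule inj_onI)
        fix p p' assume "r \<circ> p \<circ> q = r \<circ> p' \<circ> q"
        then have "inv r \<circ> (r \<circ> p \<circ> q) \<circ> inv q = inv r \<circ> (r \<circ> p' \<circ> q) \<circ> inv q" by simp
        then show "p = p'"
          using q(1) r(1) by (simp add: fun_eq_iff permutes_inverses)
      qed
      show "(\<lambda>p. r \<circ> p \<circ> q) ` {p. p permutes U \<and> p ` S = T} \<subseteq> {p. p permutes U \<and> p ` S' = T'}"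
        using q r by (auto simp: permutes_compose image_comp[symmetric])
      show "finite {p. p permutes U \<and> p ` S' = T'}"
        using finite_permutations[OF assms(1)] by (rule rev_finite_subset) auto
    qed
  qed
  show ?thesis
    using assms by (intro antisym le) auto
qed

lemma permutation_averaging:
  fixes A :: "'i \<Rightarrow> 'a set"
  assumes "finite U" "finite I"
    and F: "F \<subseteq> {S. S \<subseteq> U \<and> card S = t}"
    and A: "\<And>j. j \<in> I \<Longrightarrow> A j \<subseteq> U \<and> card (A j) = t"
    and K: "\<And>p. p permutes U \<Longrightarrow> card {j \<in> I. p ` A j \<in> F} \<le> K"
  shows "card I * card F \<le> K * (card U choose t)"
proof (cases "I = {}")
  case False
  then obtain i where i: "i \<in> I" by auto
  define P where "P = {p. p permutes U}"
  define c where "c = card {p. p permutes U \<and> p ` A i = A i}"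
  have finP: "finite P" unfolding P_def using assms(1) by (rule finite_permutations)
  define Q where "Q = {S. S \<subseteq> U \<and> card S = t}"
  have finQ: "finite Q" and cardQ: "card Q = card U choose t"
    unfolding Q_def using assms(1) n_subsets by auto
  have finF: "finite F" using F finQ finite_subset unfolding Q_def by blast
  have const: "card {p \<in> P. p ` A j = S} = c" if "j \<in> I" "S \<in> Q" for j S
    unfolding c_def P_def mem_Collect_eq
    by (rule card_permutes_image_eq) (use assms(1) A[OF that(1)] A[OF i] that(2) in \<open>auto simp: Q_def\<close>)
  have count: "card {p \<in> P. p ` A j \<in> G} = card G * c" if "j \<in> I" "G \<subseteq> Q" for j G
  proof -
    have "{p \<in> P. p ` A j \<in> G} = (\<Union>S\<in>G. {p \<in> P. p ` A j = S})" by auto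
    also have "card \<dots> = (\<Sum>S\<in>G. card {p \<in> P. p ` A j = S})"
      by (rule card_UN_disjoint) (use finP finQ that finite_subset in auto)
    also have "\<dots> = card G * c" using const that by (simp add: subset_iff)
    finally show ?thesis .
  qed
  \<comment> \<open>Counting with \<open>G = Q\<close> captures every permutation, which expresses
    \<open>card P\<close> through \<open>c\<close> and avoids evaluating either by
    factorials.\<close>
  have "{p \<in> P. p ` A i \<in> Q} = P"
  proof -
    have "p ` A i \<in> Q" if "p permutes U" for p
      using A[OF i] permutes_image[OF that] permutes_inj_on[OF that]
      by (auto simp: Q_def card_image)
    then show ?thesis by (auto simp: P_def)
  qed
  then have cardP: "card P = (card U choose t) * c"
    using count[OF i subset_refl] cardQ by simp
  \<comment> \<open>The identity witnesses \<open>c > 0\<close>, so \<open>c\<close> can be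
    cancelled at the end.\<close>
  have "id \<in> {p. p permutes U \<and> p ` A i = A i}" by simp
  moreover have "finite {p. p permutes U \<and> p ` A i = A i}"
    using finP by (rule rev_finite_subset) (auto simp: P_def)
  ultimately have "c > 0" unfolding c_def by (metis card_gt_0_iff empty_iff)
  have "card I * (card F * c) = (\<Sum>j\<in>I. card {p \<in> P. p ` A j \<in> F})"
    using count F by (simp add: Q_def)
  also have "\<dots> = (\<Sum>p\<in>P. card {j \<in> I. p ` A j \<in> F})"
    unfolding card_eq_sum using assms(2) finP by (rule sum.swap_restrict)
  also have "\<dots> \<le> (\<Sum>p\<in>P. K)"
    by (rule sum_mono) (simp add: K P_def)
  also have "\<dots> = K * (card U choose t) * c" by (simp add: cardP)
  finally show ?thesis using \<open>c > 0\<close> by (simp add: mult.assoc[symmetric])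
qed simp

section \<open>Arcs with spaced starting points\<close>

text \<open>For \<open>t \<le> n\<close>, these are the residues
  \<open>a, \<dots>, a + t - 1\<close> modulo \<open>n\<close>, with \<open>n\<close> representing
  residue 0. For \<open>a \<le> n\<close>, the summand \<open>n\<close> keeps the natural
  subtraction from truncating.\<close>

definition arc :: "nat \<Rightarrow> nat \<Rightarrow> nat \<Rightarrow> nat set" where
  "arc n t a = {p \<in> {1..n}. (p + n - a) mod n < t}"

text \<open>The offset from \<open>a\<close> maps \<open>{1..n}\<close> bijectively onto
  \<open>{..<n}\<close>, and the arc is the preimage of \<open>{..<t}\<close>.\<close>

lemma card_arc:
  assumes "a \<le> n" "t \<le> n"
  shows "card (arc n t a) = t"
proof -
  have inj: "inj_on (\<lambda>p. (p + n - a) mod n) {1..n}"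
  proof (rule linorder_inj_onI)
    fix p q assume pq: "p < q" "p \<in> {1..n}" "q \<in> {1..n}"
    have "(q + n - a) - (p + n - a) = q - p" using assms(1) by simp
    moreover have "\<not> n dvd q - p" using pq by (auto dest: dvd_imp_le)
    ultimately show "(p + n - a) mod n \<noteq> (q + n - a) mod n"
      using pq by (metis add_le_mono1 diff_le_mono less_imp_le mod_eq_dvd_iff_nat)
  qed auto
  have "(\<lambda>p. (p + n - a) mod n) ` {1..n} \<subseteq> {..<n}" by (auto intro: mod_less_divisor)
  then have surj: "(\<lambda>p. (p + n - a) mod n) ` {1..n} = {..<n}"
    using inj by (intro card_subset_eq) (auto simp: card_image)
  have "(\<lambda>p. (p + n - a) mod n) ` arc n t a = {..<t}"
  proof -
    have "(\<lambda>p. (p + n - a) mod n) ` arc n t a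
        = (\<lambda>p. (p + n - a) mod n) ` {1..n} \<inter> {..<t}"
      unfolding arc_def by auto
    then show ?thesis using surj assms(2) by auto
  qed
  moreover have "inj_on (\<lambda>p. (p + n - a) mod n) (arc n t a)"
    using inj by (rule inj_on_subset) (auto simp: arc_def)
  ultimately show ?thesis by (metis card_image card_lessThan)
qed

text \<open>\<open>f j\<close> is the offset of \<open>p\<close> from the starting point
  \<open>j * x\<close>. With \<open>e = (k - j) * x\<close>, it equals \<open>f k + e\<close> or,
  after wrapping around, \<open>f k + e - n\<close>; both \<open>e\<close> and \<open>n - e\<close>
  are at least \<open>x\<close>.\<close>

lemma mod_diff_spaced:
  fixes n x p j k :: nat
  assumes "j < k" "k * x + x \<le> n"
  defines "f \<equiv> \<lambda>j. (p + n - j * x) mod n"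
  shows "f j + x \<le> f k \<or> f k + x \<le> f j"
proof -
  define e where "e = (k - j) * x"
  have kj: "k * x = j * x + e" using assms(1) unfolding e_def by (simp flip: add_mult_distrib)
  have ex: "x \<le> e" "e + x \<le> n" using assms(1,2) kj by (auto simp: e_def Suc_le_eq)
  have "(f k + e) mod n = f j"
    unfolding f_def using assms(2) kj by (simp add: mod_add_left_eq)
  moreover have "f k < n \<or> n = 0" "f j < n \<or> n = 0" unfolding f_def by auto
  moreover have "(f k + e) mod n = (if f k + e < n then f k + e else f k + e - n)"
    if "f k < n" "n > 0"
    using that ex by (simp add: mod_if)
  ultimately show ?thesis using ex by (cases "n = 0") (auto split: if_splits)
qed

text \<open>Pigeonhole: cut the interval from \<open>b\<close> into \<open>s\<close> blocks of
  length \<open>x\<close>; no block contains two of the values.\<close>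

lemma card_spaced_le:
  fixes f :: "'i::linorder \<Rightarrow> nat"
  assumes "x > 0"
    and spaced: "\<And>j k. j \<in> J \<Longrightarrow> k \<in> J \<Longrightarrow> j < k \<Longrightarrow> f j + x \<le> f k \<or> f k + x \<le> f j"
    and range: "\<And>j. j \<in> J \<Longrightarrow> b \<le> f j \<and> f j < b + s * x"
  shows "card J \<le> s"
proof -
  have "card J \<le> card {..<s}"
  proof (rule card_inj_on_le)
    show "inj_on (\<lambda>j. (f j - b) div x) J"
    proof (rule linorder_inj_onI)
      fix j k assume jk: "j < k" "j \<in> J" "k \<in> J"
      have ne: "u div x \<noteq> v div x" if "u + x \<le> v" for u v
        using div_le_mono[OF that, of x] assms(1) by simp
      have "(f j - b) + x \<le> f k - b \<or> (f k - b) + x \<le> f j - b"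
        using spaced[OF jk(2,3,1)] range[OF jk(2)] range[OF jk(3)] by linarith
      then show "(f j - b) div x \<noteq> (f k - b) div x" using ne by metis
    qed auto
    show "(\<lambda>j. (f j - b) div x) ` J \<subseteq> {..<s}"
    proof (rule image_subsetI)
      fix j assume "j \<in> J"
      then have "f j - b < s * x" using range by fastforce
      then show "(f j - b) div x \<in> {..<s}" by (simp add: less_mult_imp_div_less)
    qed
  qed simp
  then show ?thesis by simp
qed

text \<open>Whether \<open>p\<close> lies on an arc depends only on its offset from the starting
  point, and these offsets are pairwise at least \<open>x\<close> apart. Offsets below
  \<open>t\<close> fill an interval of length at most \<open>s * x\<close> in the first case,
  offsets from \<open>t\<close> to \<open>n - 1\<close> in the second.\<close>

lemma spaced_arcs:
  assumes "x > 0" "p \<in> {1..n}"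
  shows "t \<le> s * x \<Longrightarrow> card {j \<in> {..<n div x}. p \<in> arc n t (j * x)} \<le> s"
    and "n \<le> t + s * x \<Longrightarrow> card {j \<in> {..<n div x}. p \<notin> arc n t (j * x)} \<le> s"
proof -
  define f where "f = (\<lambda>j. (p + n - j * x) mod n)"
  have spaced: "f j + x \<le> f k \<or> f k + x \<le> f j" if "j < k" "k < n div x" for j k
  proof -
    \<comment> \<open>A full step \<open>x\<close> after the starting point \<open>k * x\<close>
      still fits below \<open>n\<close>, so the spacing also holds across the wrap-around.\<close>
    have "Suc k * x \<le> n div x * x" using that(2) by (intro mult_le_mono1) simp
    also have "\<dots> \<le> n" by simp
    finally show ?thesis unfolding f_def using that(1) by (intro mod_diff_spaced) auto
  qed
  have arc: "p \<in> arc n t (j * x) \<longleftrightarrow> f j < t" for j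
    using assms(2) by (simp add: arc_def f_def)
  have fn: "f j < n" for j using assms(2) by (simp add: f_def)
  show "card {j \<in> {..<n div x}. p \<in> arc n t (j * x)} \<le> s" if "t \<le> s * x"
    by (rule card_spaced_le[where f = f and b = 0 and x = x])
      (use assms(1) spaced that in \<open>auto simp: arc\<close>)
  show "card {j \<in> {..<n div x}. p \<notin> arc n t (j * x)} \<le> s" if "n \<le> t + s * x"
    by (rule card_spaced_le[where f = f and b = t and x = x])
      (use assms(1) spaced that less_le_trans[OF fn] in \<open>auto simp: arc\<close>)
qed

text \<open>A point \<open>y\<close> in \<open>s1 + 1\<close> of the images, or outside
  \<open>s2 + 1\<close> of them, pulls back to \<open>inv p y\<close>, which is on, or off, equally
  many arcs. These arcs have distinct indices because \<open>e\<close> is injective, contradicting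
  \<open>spaced_arcs\<close>.\<close>

lemma kk_disjoint_image_arcs:
  assumes "x > 0" "t \<le> s1 * x" "n \<le> t + s2 * x"
    and p: "p permutes {1..n}"
    and e: "inj_on e {1..l}" "e ` {1..l} \<subseteq> {..<n div x}"
  shows "kk_disjoint n (s1 + 1) (s2 + 1) l (\<lambda>i. p ` arc n t (e i * x))"
proof -
  have sub: "p ` arc n t a \<subseteq> {1..n}" for a
    using permutes_image[OF p] by (auto simp: arc_def)
  have mem: "inv p y \<in> arc n t a \<longleftrightarrow> y \<in> p ` arc n t a" for y a
    using permutes_inverses[OF p] by (metis image_iff)
  have cardB: "card B \<le> card {j \<in> {..<n div x}. R j}"
    if "B \<subseteq> {1..l}" "\<And>i. i \<in> B \<Longrightarrow> R (e i)" for B R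
    by (rule card_inj_on_le[of e]) (use e that in \<open>auto intro: inj_on_subset\<close>)
  have q: "inv p y \<in> {1..n}" if "y \<in> {1..n}" for y
    using permutes_in_image[OF permutes_inv[OF p]] that by blast
  have "k_disjoint (s1 + 1) l (\<lambda>i. p ` arc n t (e i * x))"
    unfolding k_disjoint_def
  proof (intro allI impI, elim conjE, rule ccontr)
    fix B assume B: "B \<subseteq> {1..l}" "card B = s1 + 1" "(\<Inter>i\<in>B. p ` arc n t (e i * x)) \<noteq> {}"
    then obtain y where y: "\<And>i. i \<in> B \<Longrightarrow> y \<in> p ` arc n t (e i * x)" by auto
    have "B \<noteq> {}" using B(2) by auto
    then have "y \<in> {1..n}" using y sub by blast
    then have "card {j \<in> {..<n div x}. inv p y \<in> arc n t (j * x)} \<le> s1"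
      by (intro spaced_arcs(1) q assms(1,2))
    then show False using cardB[OF B(1), of "\<lambda>j. inv p y \<in> arc n t (j * x)"] y B(2) mem by simp
  qed
  moreover have "k_covering n (s2 + 1) l (\<lambda>i. p ` arc n t (e i * x))"
    unfolding k_covering_def
  proof (intro allI impI, elim conjE, rule ccontr)
    fix B assume B: "B \<subseteq> {1..l}" "card B = s2 + 1" "(\<Union>i\<in>B. p ` arc n t (e i * x)) \<noteq> {1..n}"
    then obtain y where y: "y \<in> {1..n}" "\<And>i. i \<in> B \<Longrightarrow> y \<notin> p ` arc n t (e i * x)"
      using sub by blast
    then have "card {j \<in> {..<n div x}. inv p y \<notin> arc n t (j * x)} \<le> s2"
      by (intro spaced_arcs(2) q assms(1,3))
    then show False using cardB[OF B(1), of "\<lambda>j. inv p y \<notin> arc n t (j * x)"] y B(2) mem by simp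
  qed
  ultimately show ?thesis unfolding kk_disjoint_def by simp
qed

section \<open>The bound\<close>

lemma admissible_family_card_bound:
  assumes "x > 0" "t \<le> s1 * x" "n \<le> t + s2 * x" "t \<le> n"
    and F: "admissible_family n t l (s1 + 1) (s2 + 1) F"
  shows "n div x * card F \<le> (l - 1) * (n choose t)"
proof -
  have "card {..<n div x} * card F \<le> (l - 1) * (card {1..n} choose t)"
  proof (rule permutation_averaging[where A = "\<lambda>j. arc n t (j * x)"])
    show "F \<subseteq> {S. S \<subseteq> {1..n} \<and> card S = t}" using F by (simp add: admissible_family_def)
    show "arc n t (j * x) \<subseteq> {1..n} \<and> card (arc n t (j * x)) = t" if "j \<in> {..<n div x}" for j
    proof -
      have "j * x \<le> n"
        using that by (metis lessThan_iff less_imp_le less_eq_div_iff_mult_less_eq assms(1))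
      then show ?thesis using card_arc[of "j * x" n t] assms(4) by (auto simp: arc_def)
    qed
    show "card {j \<in> {..<n div x}. p ` arc n t (j * x) \<in> F} \<le> l - 1" if p: "p permutes {1..n}" for p
    proof (rule ccontr)
      assume "\<not> ?thesis"
      \<comment> \<open>With at least \<open>l\<close> good indices, \<open>e\<close> can list
        \<open>l\<close> distinct ones; their images form a sequence forbidden in
        \<open>F\<close>.\<close>
      then have "card {1..l} \<le> card {j \<in> {..<n div x}. p ` arc n t (j * x) \<in> F}" by simp
      then obtain e where e: "e ` {1..l} \<subseteq> {j \<in> {..<n div x}. p ` arc n t (j * x) \<in> F}"
          "inj_on e {1..l}"
        using card_le_inj[of "{1..l}" "{j \<in> {..<n div x}. p ` arc n t (j * x) \<in> F}"] by auto
      have "kk_disjoint n (s1 + 1) (s2 + 1) l (\<lambda>i. p ` arc n t (e i * x))"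
        by (rule kk_disjoint_image_arcs) (use assms p e in auto)
      moreover have "\<forall>i\<in>{1..l}. p ` arc n t (e i * x) \<in> F" using e by auto
      ultimately have "\<exists>A. (\<forall>i\<in>{1..l}. A i \<in> F) \<and> kk_disjoint n (s1 + 1) (s2 + 1) l A"
        by (intro exI[of _ "\<lambda>i. p ` arc n t (e i * x)"] conjI)
      then show False using F unfolding admissible_family_def by (elim conjE notE)
    qed
  qed auto
  then show ?thesis by simp
qed

text \<open>The maximum ranges over a finite set, which is nonempty because for \<open>l > 0\<close>
  the empty family has no member to serve as \<open>A 1\<close>.\<close>

lemma m_attained:
  assumes "l > 0"
  obtains F where "admissible_family n t l k1 k2 F" "m n t l k1 k2 = card F"
proof -
  have "finite {F. admissible_family n t l k1 k2 F}"
    by (rule finite_subset[of _ "Pow (Pow {1..n})"]) (auto simp: admissible_family_def)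
  then have "finite {card F | F. admissible_family n t l k1 k2 F}" by simp
  moreover have "admissible_family n t l k1 k2 {}"
    using assms by (auto simp: admissible_family_def intro!: exI[of _ 1])
  ultimately have "m n t l k1 k2 \<in> {card F | F. admissible_family n t l k1 k2 F}"
    unfolding m_def by (intro Max_in) auto
  then show ?thesis using that by auto
qed

theorem theorem5p1:
  fixes n t l s1 s2 :: nat and \<chi> :: int
  assumes "n > 0" and "t > 0" and "l > 0" and "s1 > 0" and "s2 > 0"
    and "n > t" and "t > 1"
    and "min (s1 + 1) (s2 + 1) \<le> l" and "l \<le> s1 + s2"
    and "\<chi> = max \<lceil>real t / real s1\<rceil> \<lceil>(real n - real t) / real s2\<rceil>"
  shows "real (m n t l (s1 + 1) (s2 + 1)) \<le>
    1 / real n * real (n choose t) * (real l - 1) *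
      of_int \<lceil>real n / of_int \<lfloor>real n / of_int \<chi>\<rfloor>\<rceil>"
proof -
  have "\<chi> > 0" using assms by (simp add: less_max_iff_disj)
  define x where "x = nat \<chi>"
  have x: "x > 0" "\<chi> = int x" using \<open>\<chi> > 0\<close> by (auto simp: x_def)
  have "real t / real s1 \<le> real x" "(real n - real t) / real s2 \<le> real x"
    using assms(10) x(2) by (metis ceiling_le_iff max.cobounded1 of_int_of_nat_eq,
      metis ceiling_le_iff max.cobounded2 of_int_of_nat_eq)
  then have "real t \<le> real (s1 * x)" "real n \<le> real (t + s2 * x)"
    using assms by (auto simp: field_simps)
  then have tx: "t \<le> s1 * x" "n \<le> t + s2 * x" by (simp_all only: of_nat_le_iff)
  define d where "d = n div x"
  \<comment> \<open>Since \<open>s1\<close> and \<open>s2\<close> are at least 1, both quotients in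
    \<open>\<chi>\<close> are at most \<open>n\<close>; hence \<open>d > 0\<close> and division by
    \<open>d\<close> is meaningful.\<close>
  have "x \<le> n"
  proof -
    have "real t / real s1 \<le> real t / 1" "(real n - real t) / real s2 \<le> (real n - real t) / 1"
      using assms by (intro divide_left_mono; simp)+
    then have "\<chi> \<le> int n"
      unfolding assms(10) using assms(6) by (auto simp: ceiling_le_iff)
    then show ?thesis using x by simp
  qed
  then have "d > 0" using x by (simp add: d_def div_greater_zero_iff)
  have d: "\<lfloor>real n / of_int \<chi>\<rfloor> = int d"
    using x(2) by (simp add: d_def floor_divide_of_nat_eq)
  obtain F where F: "admissible_family n t l (s1 + 1) (s2 + 1) F" "m n t l (s1 + 1) (s2 + 1) = card F"
    using m_attained[OF assms(3)] by blast
  have "d * card F \<le> (l - 1) * (n choose t)"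
    unfolding d_def using admissible_family_card_bound[OF x(1) tx _ F(1)] assms(6) by simp
  \<comment> \<open>\<open>l > 0\<close> makes the truncated \<open>l - 1\<close> agree with the
    real difference.\<close>
  then have "real d * real (card F) \<le> (real l - 1) * real (n choose t)"
    using assms(3) by (metis (mono_tags) of_nat_1 of_nat_diff of_nat_le_iff of_nat_mult Suc_leI One_nat_def)
  then have "real (card F) \<le> (real l - 1) * real (n choose t) / real d"
    using \<open>d > 0\<close> by (simp add: pos_le_divide_eq mult.commute)
  \<comment> \<open>Written this way, the bound differs from the claim only by rounding
    \<open>n / d\<close> up.\<close>
  also have "\<dots> = 1 / real n * real (n choose t) * (real l - 1) * (real n / real d)"
    using assms(1) by simp
  also have "\<dots> \<le> 1 / real n * real (n choose t) * (real l - 1) * of_int \<lceil>real n / real d\<rceil>"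
    using assms(3) by (intro mult_left_mono) auto
  finally show ?thesis unfolding F(2) d of_int_of_nat_eq .
qed

end
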